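(* Let $a<b$, let $\phi_1,\phi_2$ be continuous real functions on $I=[a,b]$ with $\phi_1<\phi_2$ on $I$, and let $\Omega=\{(x,y)\in\mathbb{R}^2:\ a\leqslant x\leqslant b,\ \phi_1(x)\leqslant y\leqslant\phi_2(x)\}$. Let the integers $n_k$ be given either by $n_k=n-k$ for all $0\leqslant k\leqslant n$ and all $n$, or by $n_k=k$ for all $0\leqslant k\leqslant n$ and all $n$, and let $\widetilde{\mathscr{B}}_n[\,\cdot\,,\Omega]$ be the corresponding shifted $n$-th Bernstein-Stancu operator. Let $f(x,y)$ be a bounded function on $\Omega$, and let $(x_0,y_0)\in\Omega$ be a point at which $f(x,y)$ admits second order partial derivatives, and such that $\phi_i''(x_0)$, $i=1,2$, exist. Then, as $n\to+\infty$, $$\left.\widetilde{\mathscr{B}}_n[f(x,y),\Omega]\right|_{(x,y)=(x_0,y_0)}-f(x_0,y_0)=\mathcal{O}\left(\frac{1}{n}\right).$$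
   Context: For integers $0\leqslant k\leqslant n$ let $p_{n,k}(s)=\binom{n}{k}s^k(1-s)^{n-k}$, $0\leqslant s\leqslant 1$ (with $0^0=1$). For a function $f$ on $\Omega$ and $u,v\in[0,1]$ put $\widetilde{\phi}_i(u)=\phi_i((b-a)u+a)$, $i=1,2$, and $$\widetilde{F}(u,v;\Omega)=f\big((b-a)u+a,\ (\widetilde{\phi}_2(u)-\widetilde{\phi}_1(u))\,v+\widetilde{\phi}_1(u)\big).$$ The shifted $n$-th Bernstein-Stancu operator ($n\geqslant 1$) is $$\widetilde{\mathscr{B}}_n[f(x,y),\Omega]=\sum_{k=0}^n\sum_{j=0}^{n_k}\widetilde{F}\left(\frac{k}{n},\frac{j}{n_k};\Omega\right)p_{n,k}\left(\frac{x-a}{b-a}\right)p_{n_k,j}\left(\frac{y-\phi_1(x)}{\phi_2(x)-\phi_1(x)}\right),\quad (x,y)\in\Omega.$$ When $n_k=0$ the only index is $j=0$, and $j/n_k$ is read as $0$.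
   Formalization: "f admits second order partial derivatives at (x_0,y_0)" is read as: f_x, f_y exist on Ω near the point and are differentiable there (bare existence fails: x²y²/(x⁴+y⁴)); if n_k=n-k and x_0=b, or n_k=k and x_0=a, only y_0=φ_1(x_0) is allowed (else false: f=y). *)

theory Defs
  imports "HOL-Analysis.Analysis" "HOL-Library.Landau_Symbols"
begin

definition curved_domain ::
    "real \<Rightarrow> real \<Rightarrow> (real \<Rightarrow> real) \<Rightarrow> (real \<Rightarrow> real) \<Rightarrow> (real \<times> real) set" where
  "curved_domain a b \<phi>1 \<phi>2 = {(x, y). a \<le> x \<and> x \<le> b \<and> \<phi>1 x \<le> y \<and> y \<le> \<phi>2 x}"

definition shift_fun :: "real \<Rightarrow> real \<Rightarrow> (real \<Rightarrow> real) \<Rightarrow> real \<Rightarrow> real" where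
  "shift_fun a b \<phi> u = \<phi> ((b - a) * u + a)"

definition shift_fun2 ::
    "real \<Rightarrow> real \<Rightarrow> (real \<Rightarrow> real) \<Rightarrow> (real \<Rightarrow> real) \<Rightarrow> (real \<times> real \<Rightarrow> real) \<Rightarrow> real \<Rightarrow> real \<Rightarrow> real" where
  "shift_fun2 a b \<phi>1 \<phi>2 f u v =
     f ((b - a) * u + a,
        (shift_fun a b \<phi>2 u - shift_fun a b \<phi>1 u) * v + shift_fun a b \<phi>1 u)"

text \<open>
  The integer \<open>n\<^sub>k\<close> is \<open>N n k\<close>; the basis polynomial \<open>p\<^sub>n\<^sub>,\<^sub>k\<close> is the library's
  \<^const>\<open>Bernstein\<close>.  If \<open>N n k = 0\<close>, the only inner index is \<open>j = 0\<close>, and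
  \<open>real j / real (N n k)\<close> is \<open>0 / 0 = 0\<close>, as the convention for this case requires.
\<close>

definition shifted_Bernstein_Stancu ::
    "(nat \<Rightarrow> nat \<Rightarrow> nat) \<Rightarrow> real \<Rightarrow> real \<Rightarrow> (real \<Rightarrow> real) \<Rightarrow> (real \<Rightarrow> real) \<Rightarrow>
     nat \<Rightarrow> (real \<times> real \<Rightarrow> real) \<Rightarrow> real \<times> real \<Rightarrow> real" where
  "shifted_Bernstein_Stancu N a b \<phi>1 \<phi>2 n f = (\<lambda>(x, y).
     \<Sum>k=0..n. \<Sum>j=0..N n k.
       shift_fun2 a b \<phi>1 \<phi>2 f (real k / real n) (real j / real (N n k))
       * Bernstein n k ((x - a) / (b - a))
       * Bernstein (N n k) j ((y - \<phi>1 x) / (\<phi>2 x - \<phi>1 x)))"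

text \<open>
  Derivatives are taken within the domain, so they are one-sided at its boundary.
\<close>

definition has_second_derivative_at_within :: "(real \<Rightarrow> real) \<Rightarrow> real \<Rightarrow> real set \<Rightarrow> bool" where
  "has_second_derivative_at_within \<phi> x0 S \<longleftrightarrow>
     (\<exists>\<phi>' D. (\<forall>\<^sub>F x in nhds x0. x \<in> S \<longrightarrow> (\<phi> has_real_derivative \<phi>' x) (at x within S)) \<and>
             (\<phi>' has_real_derivative D) (at x0 within S))"

text \<open>
  First order partial derivatives \<open>fx\<close>, \<open>fy\<close> exist at all points of \<open>S\<close> near \<open>p0\<close>, each
  computed along the slice of \<open>S\<close> through the point, and \<open>fx\<close>, \<open>fy\<close> are differentiable at
  \<open>p0\<close>; the second order partial derivatives at \<open>p0\<close> are the components \<open>fxx\<close>, \<open>fxy\<close>,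
  \<open>fyx\<close>, \<open>fyy\<close> of their differentials.  Differentiability of \<open>fx\<close> and \<open>fy\<close>
  at \<open>p0\<close>, and not just existence of the four numbers, is needed to have a second order
  Taylor expansion of \<open>f\<close> at \<open>p0\<close>: the function \<open>x\<^sup>2 y\<^sup>2 / (x\<^sup>4 + y\<^sup>4)\<close> (with value 0 at
  the origin) has partial derivatives of second order everywhere but is
  discontinuous at the origin.  It is implied by continuity of the second order
  partial derivatives in a neighbourhood of \<open>p0\<close>.
\<close>

definition has_second_partials_at_within ::
    "(real \<times> real \<Rightarrow> real) \<Rightarrow> real \<times> real \<Rightarrow> (real \<times> real) set \<Rightarrow> bool" where
  "has_second_partials_at_within f p0 S \<longleftrightarrow>
     (\<exists>fx fy fxx fxy fyx fyy.
        (\<forall>\<^sub>F (x, y) in nhds p0. (x, y) \<in> S \<longrightarrow>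
           ((\<lambda>s. f (s, y)) has_real_derivative fx (x, y)) (at x within {s. (s, y) \<in> S}) \<and>
           ((\<lambda>t. f (x, t)) has_real_derivative fy (x, y)) (at y within {t. (x, t) \<in> S})) \<and>
        (fx has_derivative (\<lambda>(h, k). fxx * h + fxy * k)) (at p0 within S) \<and>
        (fy has_derivative (\<lambda>(h, k). fyx * h + fyy * k)) (at p0 within S))"

end

theory Submission
  imports Defs
begin

text \<open>
  In the coordinates \<open>u = (x - a) / (b - a)\<close>, \<open>v = (y - \<phi>1 x) / (\<phi>2 x - \<phi>1 x)\<close> the domain becomes
  the unit square, and the operator averages the values of \<open>f\<close> at the nodes \<open>(k / n, j / n\<^sub>k)\<close>, where
  \<open>k\<close> is binomially distributed with parameters \<open>n\<close>, \<open>s\<close> and, given \<open>k\<close>, \<open>j\<close> is binomially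
  distributed with parameters \<open>n\<^sub>k\<close>, \<open>t\<close>; here \<open>(s, t)\<close> are the new coordinates of \<open>(x0, y0)\<close>.
  If \<open>f\<close> is linear in \<open>(u, v)\<close> at \<open>(s, t)\<close> up to an error \<open>C * ((u - s)\<^sup>2 + (v - t)\<^sup>2)\<close> on the
  whole square, then only the first two moments of the nodes matter.

  Moments: \<open>k / n\<close> has mean \<open>s\<close> and variance at most \<open>1 / n\<close>.  Given \<open>k\<close>, the number \<open>j / n\<^sub>k\<close> has
  mean \<open>t\<close>, except that for \<open>n\<^sub>k = 0\<close> it is \<open>0\<close>; in all cases both its bias and its mean square
  deviation from \<open>t\<close> are at most \<open>2 * t / (n\<^sub>k + 1)\<close>.  So everything comes down to the mean of
  \<open>1 / (n\<^sub>k + 1)\<close>.  Since \<open>n\<^sub>k\<close> is itself binomial with parameters \<open>n\<close>, \<open>p\<close>, where \<open>p = s\<close> or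
  \<open>p = 1 - s\<close>, an index shift in the binomial coefficients bounds this mean by
  \<open>1 / ((n + 1) * p)\<close> (\<open>Bernstein_reciprocal_moment\<close>).  When \<open>p = 0\<close>, the point lies on the
  vertical edge where \<open>n\<^sub>k = 0\<close> almost surely, and there \<open>t = 0\<close> removes the term altogether.

  Expansion: near \<open>(x0, y0)\<close> the partial derivatives of \<open>f\<close> differ from their values at \<open>(x0, y0)\<close>
  by at most a multiple of the distance, so the mean value theorem along axis-parallel segments
  gives a linear approximation of \<open>f\<close> with quadratic error (\<open>Taylor_of_slicewise_partials\<close>).  The
  point may lie on a curved boundary, so the segments have to be chosen inside the domain: go
  vertically, by at most a multiple of \<open>\<bar>x - x0\<bar>\<close>, to a level that stays between the two curves all
  the way to \<open>x\<close>, then horizontally, then vertically again.  The second derivatives of \<open>\<phi>1\<close> and \<open>\<phi>2\<close> carry the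
  expansion over to \<open>(u, v)\<close>, and boundedness of \<open>f\<close> extends it to the whole square
  (\<open>expansion_in_straightened_coordinates\<close>).
\<close>

section \<open>Linear approximation with quadratic error\<close>

text \<open>Mean value inequality for \<open>g z - c * z\<close>.\<close>

lemma increment_bound_of_slope_bound:
  fixes g :: "real \<Rightarrow> real"
  assumes "\<And>z. z \<in> closed_segment x y \<Longrightarrow> (g has_real_derivative g' z) (at z within closed_segment x y)"
    and "\<And>z. z \<in> closed_segment x y \<Longrightarrow> \<bar>g' z - c\<bar> \<le> B"
  shows "\<bar>g y - g x - c * (y - x)\<bar> \<le> B * \<bar>y - x\<bar>"
proof -
  have "norm ((g y - c * y) - (g x - c * x)) \<le> B * norm (y - x)"
  proof (rule field_differentiable_bound[where S = "closed_segment x y" and f = "\<lambda>z. g z - c * z"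
        and f' = "\<lambda>z. g' z - c"])
    show "((\<lambda>z. g z - c * z) has_field_derivative g' z - c) (at z within closed_segment x y)"
      if "z \<in> closed_segment x y" for z
      by (auto intro!: derivative_eq_intros assms(1) that)
    show "norm (g' z - c) \<le> B" if "z \<in> closed_segment x y" for z
      using assms(2)[OF that] by simp
  qed auto
  then show ?thesis by (simp add: algebra_simps)
qed

lemma has_derivative_imp_locally_Lipschitz_at:
  fixes g :: "'a :: real_normed_vector \<Rightarrow> real"
  assumes "(g has_derivative D) (at p within S)"
  obtains C d where "C \<ge> 0" "d > 0"
    "\<And>q. q \<in> S \<Longrightarrow> norm (q - p) < d \<Longrightarrow> \<bar>g q - g p\<bar> \<le> C * norm (q - p)"
proof -
  have bl: "bounded_linear D"
    using assms by (rule has_derivative_bounded_linear)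
  obtain d where d: "d > 0"
    "\<And>q. q \<in> S \<Longrightarrow> norm (q - p) < d \<Longrightarrow> norm (g q - g p - D (q - p)) \<le> 1 * norm (q - p)"
    using assms unfolding has_derivative_within_alt by (metis zero_less_one)
  obtain K where K: "K > 0" "\<And>x. norm (D x) \<le> norm x * K"
    using bounded_linear.pos_bounded[OF bl] by auto
  show ?thesis
  proof (rule that[of "K + 1" d])
    fix q assume q: "q \<in> S" "norm (q - p) < d"
    show "\<bar>g q - g p\<bar> \<le> (K + 1) * norm (q - p)"
      using d(2)[OF q] K(2)[of "q - p"] by (simp add: algebra_simps)
  qed (use K d in auto)
qed

text \<open>
  The derivative is Lipschitz at \<open>x0\<close> relative to the value there, so the mean value inequality
  with slope \<open>\<phi>' x0\<close> leaves an error of order \<open>\<bar>x - x0\<bar> * \<bar>x - x0\<bar>\<close>.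
\<close>

lemma second_derivative_imp_quadratic_error:
  fixes \<phi> :: "real \<Rightarrow> real"
  assumes "has_second_derivative_at_within \<phi> x0 S" "convex S" "x0 \<in> S"
  obtains c C d where "C \<ge> 0" "d > 0"
    "\<And>x. x \<in> S \<Longrightarrow> \<bar>x - x0\<bar> < d \<Longrightarrow> \<bar>\<phi> x - \<phi> x0 - c * (x - x0)\<bar> \<le> C * (x - x0)\<^sup>2"
proof -
  obtain \<phi>' D where
      ev: "\<forall>\<^sub>F x in nhds x0. x \<in> S \<longrightarrow> (\<phi> has_real_derivative \<phi>' x) (at x within S)" and
      D: "(\<phi>' has_real_derivative D) (at x0 within S)"
    using assms(1) unfolding has_second_derivative_at_within_def by blast
  obtain d1 where d1: "d1 > 0"
    "\<And>x. \<bar>x - x0\<bar> < d1 \<Longrightarrow> x \<in> S \<Longrightarrow> (\<phi> has_real_derivative \<phi>' x) (at x within S)"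
    using ev unfolding eventually_nhds_metric by (auto simp: dist_real_def)
  obtain C d2 where C: "C \<ge> 0" "d2 > 0"
    "\<And>q. q \<in> S \<Longrightarrow> norm (q - x0) < d2 \<Longrightarrow> \<bar>\<phi>' q - \<phi>' x0\<bar> \<le> C * norm (q - x0)"
    using has_derivative_imp_locally_Lipschitz_at[OF D[unfolded has_field_derivative_def]] by metis
  show ?thesis
  proof (rule that[of C "min d1 d2" "\<phi>' x0"])
    fix x assume x: "x \<in> S" "\<bar>x - x0\<bar> < min d1 d2"
    have seg: "closed_segment x0 x \<subseteq> S"
      using assms x by (simp add: closed_segment_subset)
    have near: "\<bar>z - x0\<bar> \<le> \<bar>x - x0\<bar>" if "z \<in> closed_segment x0 x" for z
      using that by (auto simp: closed_segment_eq_real_ivl split: if_splits)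
    have "\<bar>\<phi> x - \<phi> x0 - \<phi>' x0 * (x - x0)\<bar> \<le> (C * \<bar>x - x0\<bar>) * \<bar>x - x0\<bar>"
    proof (rule increment_bound_of_slope_bound)
      fix z assume z: "z \<in> closed_segment x0 x"
      then have zS: "z \<in> S" and zd: "\<bar>z - x0\<bar> < min d1 d2"
        using seg near[OF z] x by auto
      show "(\<phi> has_real_derivative \<phi>' z) (at z within closed_segment x0 x)"
        using d1(2)[OF _ zS] zd seg by (auto intro: DERIV_subset)
      have "\<bar>\<phi>' z - \<phi>' x0\<bar> \<le> C * \<bar>z - x0\<bar>"
        using C(3)[OF zS] zd by simp
      also have "\<dots> \<le> C * \<bar>x - x0\<bar>"
        using near[OF z] C(1) by (rule mult_left_mono)
      finally show "\<bar>\<phi>' z - \<phi>' x0\<bar> \<le> C * \<bar>x - x0\<bar>" .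
    qed
    then show "\<bar>\<phi> x - \<phi> x0 - \<phi>' x0 * (x - x0)\<bar> \<le> C * (x - x0)\<^sup>2"
      by (simp add: power2_eq_square mult.assoc)
  qed (use C d1 in auto)
qed

text \<open>
  The rectangle spanned by \<open>(x0, y0)\<close> and \<open>(x, y)\<close> need not lie in the domain when \<open>(x0, y0)\<close> is
  on one of the curves, and the horizontal slice through \<open>(x0, y0)\<close> may even be a single point.
  Vertical slices, however, are intervals, and since the curves are Lipschitz at \<open>x0\<close>, some
  horizontal segment over \<open>[x0, x]\<close>, at distance \<open>O(\<bar>x - x0\<bar>)\<close> from \<open>y0\<close>, lies between them.  So
  the two points are joined inside the domain by a vertical, a horizontal and a vertical
  segment, all of length and distance to \<open>(x0, y0)\<close> of order \<open>\<bar>x - x0\<bar> + \<bar>y - y0\<bar>\<close>.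
\<close>

lemma Taylor_of_slicewise_partials:
  fixes \<phi>1 \<phi>2 :: "real \<Rightarrow> real" and f :: "real \<times> real \<Rightarrow> real" and a b x0 y0 :: real
  defines "S \<equiv> curved_domain a b \<phi>1 \<phi>2"
  assumes p0: "(x0, y0) \<in> S" and lt: "\<phi>1 x0 < \<phi>2 x0"
    and M: "0 \<le> M" and d0: "0 < d0"
    and Lip1: "\<And>x. x \<in> {a..b} \<Longrightarrow> \<bar>x - x0\<bar> < d0 \<Longrightarrow> \<bar>\<phi>1 x - \<phi>1 x0\<bar> \<le> M * \<bar>x - x0\<bar>"
    and Lip2: "\<And>x. x \<in> {a..b} \<Longrightarrow> \<bar>x - x0\<bar> < d0 \<Longrightarrow> \<bar>\<phi>2 x - \<phi>2 x0\<bar> \<le> M * \<bar>x - x0\<bar>"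
    and partials: "has_second_partials_at_within f (x0, y0) S"
  obtains A B C d where "0 \<le> C" "0 < d"
    "\<And>x y. (x, y) \<in> S \<Longrightarrow> \<bar>x - x0\<bar> + \<bar>y - y0\<bar> < d \<Longrightarrow>
       \<bar>f (x, y) - f (x0, y0) - A * (x - x0) - B * (y - y0)\<bar> \<le> C * (\<bar>x - x0\<bar> + \<bar>y - y0\<bar>)\<^sup>2"
proof -
  obtain fx fy fxx fxy fyx fyy where
      ev: "\<forall>\<^sub>F (x, y) in nhds (x0, y0). (x, y) \<in> S \<longrightarrow>
           ((\<lambda>s. f (s, y)) has_real_derivative fx (x, y)) (at x within {s. (s, y) \<in> S}) \<and>
           ((\<lambda>t. f (x, t)) has_real_derivative fy (x, y)) (at y within {t. (x, t) \<in> S})" and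
      Dx: "(fx has_derivative (\<lambda>(h, k). fxx * h + fxy * k)) (at (x0, y0) within S)" and
      Dy: "(fy has_derivative (\<lambda>(h, k). fyx * h + fyy * k)) (at (x0, y0) within S)"
    using partials unfolding has_second_partials_at_within_def by (elim exE conjE) (rule that)
  obtain d1 where d1: "d1 > 0"
    "\<And>p. dist p (x0, y0) < d1 \<Longrightarrow> (case p of (x, y) \<Rightarrow> (x, y) \<in> S \<longrightarrow>
           ((\<lambda>s. f (s, y)) has_real_derivative fx (x, y)) (at x within {s. (s, y) \<in> S}) \<and>
           ((\<lambda>t. f (x, t)) has_real_derivative fy (x, y)) (at y within {t. (x, t) \<in> S}))"
    using ev unfolding eventually_nhds_metric by blast
  obtain C1 d2 where C1: "C1 \<ge> 0" "d2 > 0"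
    "\<And>q. q \<in> S \<Longrightarrow> norm (q - (x0, y0)) < d2 \<Longrightarrow> \<bar>fx q - fx (x0, y0)\<bar> \<le> C1 * norm (q - (x0, y0))"
    by (rule has_derivative_imp_locally_Lipschitz_at[OF Dx]) (rule that)
  obtain C2 d3 where C2: "C2 \<ge> 0" "d3 > 0"
    "\<And>q. q \<in> S \<Longrightarrow> norm (q - (x0, y0)) < d3 \<Longrightarrow> \<bar>fy q - fy (x0, y0)\<bar> \<le> C2 * norm (q - (x0, y0))"
    by (rule has_derivative_imp_locally_Lipschitz_at[OF Dy]) (rule that)
  define C where "C = max C1 C2"
  define \<delta> where "\<delta> = min (min d1 d2) d3"
  have C0: "0 \<le> C" and \<delta>0: "0 < \<delta>"
    using C1 C2 d1 by (auto simp: C_def \<delta>_def)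
  define A where "A = fx (x0, y0)"
  define B where "B = fy (x0, y0)"
  have near: "((\<lambda>s. f (s, y)) has_real_derivative fx (x, y)) (at x within {s. (s, y) \<in> S})"
             "((\<lambda>t. f (x, t)) has_real_derivative fy (x, y)) (at y within {t. (x, t) \<in> S})"
             "\<bar>fx (x, y) - A\<bar> \<le> C * r" "\<bar>fy (x, y) - B\<bar> \<le> C * r"
    if "(x, y) \<in> S" "\<bar>x - x0\<bar> + \<bar>y - y0\<bar> \<le> r" "r < \<delta>" for x y r
  proof -
    have n: "norm ((x, y) - (x0, y0)) \<le> r"
      using norm_Pair_le[of "x - x0" "y - y0"] that by simp
    then have "norm ((x, y) - (x0, y0)) < d1" "norm ((x, y) - (x0, y0)) < d2"
        "norm ((x, y) - (x0, y0)) < d3"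
      using that by (auto simp: \<delta>_def)
    note d = this
    show "((\<lambda>s. f (s, y)) has_real_derivative fx (x, y)) (at x within {s. (s, y) \<in> S})"
         "((\<lambda>t. f (x, t)) has_real_derivative fy (x, y)) (at y within {t. (x, t) \<in> S})"
      using d1(2)[OF d(1)[folded dist_norm]] that(1) by auto
    have "C1 * norm ((x, y) - (x0, y0)) \<le> C * r" "C2 * norm ((x, y) - (x0, y0)) \<le> C * r"
      using n C0 by (auto intro!: mult_mono simp: C_def)
    then show "\<bar>fx (x, y) - A\<bar> \<le> C * r" "\<bar>fy (x, y) - B\<bar> \<le> C * r"
      using C1(3)[OF that(1) d(2)] C2(3)[OF that(1) d(3)] by (auto simp: A_def B_def)
  qed
  have horizontal: "\<bar>f (x2, y) - f (x1, y) - A * (x2 - x1)\<bar> \<le> C * r * \<bar>x2 - x1\<bar>"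
    if "\<And>s. s \<in> closed_segment x1 x2 \<Longrightarrow> (s, y) \<in> S \<and> \<bar>s - x0\<bar> + \<bar>y - y0\<bar> \<le> r" "r < \<delta>" for x1 x2 y r
  proof (rule increment_bound_of_slope_bound)
    fix s assume s: "s \<in> closed_segment x1 x2"
    have "closed_segment x1 x2 \<subseteq> {s. (s, y) \<in> S}" using that(1) by blast
    then show "((\<lambda>s. f (s, y)) has_real_derivative fx (s, y)) (at s within closed_segment x1 x2)"
      using near(1)[of s y r] that(1)[OF s] that(2) by (blast intro: DERIV_subset)
    show "\<bar>fx (s, y) - A\<bar> \<le> C * r"
      using near(3)[of s y r] that(1)[OF s] that(2) by blast
  qed
  have vertical: "\<bar>f (x, y2) - f (x, y1) - B * (y2 - y1)\<bar> \<le> C * r * \<bar>y2 - y1\<bar>"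
    if "\<And>t. t \<in> closed_segment y1 y2 \<Longrightarrow> (x, t) \<in> S \<and> \<bar>x - x0\<bar> + \<bar>t - y0\<bar> \<le> r" "r < \<delta>" for x y1 y2 r
  proof (rule increment_bound_of_slope_bound)
    fix t assume t: "t \<in> closed_segment y1 y2"
    have "closed_segment y1 y2 \<subseteq> {t. (x, t) \<in> S}" using that(1) by blast
    then show "((\<lambda>t. f (x, t)) has_real_derivative fy (x, t)) (at t within closed_segment y1 y2)"
      using near(2)[of x t r] that(1)[OF t] that(2) by (blast intro: DERIV_subset)
    show "\<bar>fy (x, t) - B\<bar> \<le> C * r"
      using near(4)[of x t r] that(1)[OF t] that(2) by blast
  qed
  define w where "w = \<phi>2 x0 - \<phi>1 x0"
  have w: "w > 0" using lt by (simp add: w_def)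
  define v0 where "v0 = (y0 - \<phi>1 x0) / w"
  have y0_eq: "y0 = (1 - v0) * \<phi>1 x0 + v0 * \<phi>2 x0"
  proof -
    have "v0 * w = y0 - \<phi>1 x0" using w by (simp add: v0_def)
    then show ?thesis by (simp add: w_def algebra_simps)
  qed
  have v0: "0 \<le> v0" "v0 \<le> 1"
    using p0 w by (auto simp: v0_def S_def curved_domain_def w_def)
  \<comment> \<open>The bound \<open>w / 2\<close> ensures that the cones around the two curves do not meet.\<close>
  define d where "d = min (min d0 \<delta>) (w / 2) / (1 + M)"
  have dpos: "d > 0" using d0 \<delta>0 w M by (simp add: d_def)
  show ?thesis
  proof (rule that[of "3 * C * (1 + M)\<^sup>2" d A B])
    fix x y assume xy: "(x, y) \<in> S" "\<bar>x - x0\<bar> + \<bar>y - y0\<bar> < d"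
    define h where "h = \<bar>x - x0\<bar>"
    define \<rho> where "\<rho> = h + \<bar>y - y0\<bar>"
    define r where "r = (1 + M) * \<rho>"
    have h0: "0 \<le> h" "h \<le> \<rho>" by (auto simp: h_def \<rho>_def)
    have "(1 + M) * \<rho> < (1 + M) * d"
      using xy M by (intro mult_strict_left_mono) (auto simp: \<rho>_def h_def)
    also have "\<dots> = min (min d0 \<delta>) (w / 2)" using M by (simp add: d_def)
    finally have r: "r < d0" "r < \<delta>" "r < w / 2" by (auto simp: r_def)
    have Mh0: "0 \<le> M * h" using M h0 by simp
    have hr: "h + \<bar>y - y0\<bar> + M * h \<le> r"
      using M mult_left_mono[OF h0(2) M] by (simp add: r_def \<rho>_def algebra_simps)
    \<comment> \<open>The level \<open>c\<close> of the horizontal segment divides the interval that remains between the two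
        Lipschitz cones in the same ratio as \<open>y0\<close> divides \<open>[\<phi>1 x0, \<phi>2 x0]\<close>.  This treats
        interior points and points on either curve alike.\<close>
    define c where "c = (1 - v0) * (\<phi>1 x0 + M * h) + v0 * (\<phi>2 x0 - M * h)"
    have c_near: "\<bar>c - y0\<bar> \<le> M * h"
    proof -
      have "c - y0 = (1 - 2 * v0) * (M * h)"
        by (simp add: c_def y0_eq algebra_simps)
      moreover have "\<bar>1 - 2 * v0\<bar> * \<bar>M * h\<bar> \<le> 1 * \<bar>M * h\<bar>"
        using v0 by (intro mult_right_mono) auto
      ultimately show ?thesis using Mh0 by (simp add: abs_mult)
    qed
    have mid: "\<phi>1 x0 + M * h \<le> \<phi>2 x0 - M * h"
      using r(3) hr h0 by (simp add: w_def)
    have c_ge: "\<phi>1 x0 + M * h \<le> c"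
    proof -
      have "v0 * (\<phi>1 x0 + M * h) \<le> v0 * (\<phi>2 x0 - M * h)" using mid v0 by (intro mult_left_mono)
      then show ?thesis by (simp add: c_def algebra_simps)
    qed
    have c_le: "c \<le> \<phi>2 x0 - M * h"
    proof -
      have "(1 - v0) * (\<phi>1 x0 + M * h) \<le> (1 - v0) * (\<phi>2 x0 - M * h)"
        using mid v0 by (intro mult_left_mono) auto
      then show ?thesis by (simp add: c_def algebra_simps)
    qed
    have xab: "x0 \<in> {a..b}" "x \<in> {a..b}"
      using p0 xy by (auto simp: S_def curved_domain_def)
    have seg: "s \<in> {a..b}" "\<bar>s - x0\<bar> \<le> h" if "s \<in> closed_segment x0 x" for s
      using that xab by (auto simp: closed_segment_eq_real_ivl h_def split: if_splits)
    have cS: "(s, c) \<in> S" if "s \<in> closed_segment x0 x" for s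
    proof -
      have "\<bar>s - x0\<bar> < d0" using seg(2)[OF that] hr r Mh0 by linarith
      moreover have "M * \<bar>s - x0\<bar> \<le> M * h" using seg(2)[OF that] M by (rule mult_left_mono)
      ultimately show ?thesis
        using Lip1[of s] Lip2[of s] seg(1)[OF that] c_ge c_le
        by (auto simp: S_def curved_domain_def)
    qed
    have vS: "(s, t) \<in> S" if "(s, y1) \<in> S" "(s, y2) \<in> S" "t \<in> closed_segment y1 y2" for s y1 y2 t
      using that by (auto simp: S_def curved_domain_def closed_segment_eq_real_ivl split: if_splits)
    \<comment> \<open>The mean value inequality on the three segments; on each, the slope error and the length
        are at most \<open>C * r\<close> and \<open>r\<close>.\<close>
    have "\<bar>f (x0, c) - f (x0, y0) - B * (c - y0)\<bar> \<le> C * r * \<bar>c - y0\<bar>"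
    proof (rule vertical)
      fix t assume t: "t \<in> closed_segment y0 c"
      have "\<bar>t - y0\<bar> \<le> \<bar>c - y0\<bar>"
        using t by (auto simp: closed_segment_eq_real_ivl split: if_splits)
      then show "(x0, t) \<in> S \<and> \<bar>x0 - x0\<bar> + \<bar>t - y0\<bar> \<le> r"
        using vS[OF p0 cS[of x0] t] c_near hr h0 by auto
    qed (rule r)
    also have "\<dots> \<le> C * r * r"
      using C0 c_near hr h0 Mh0 by (intro mult_left_mono) auto
    finally have e1: "\<bar>f (x0, c) - f (x0, y0) - B * (c - y0)\<bar> \<le> C * r * r" .
    have "\<bar>f (x, c) - f (x0, c) - A * (x - x0)\<bar> \<le> C * r * \<bar>x - x0\<bar>"
    proof (rule horizontal)
      fix s assume s: "s \<in> closed_segment x0 x"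
      show "(s, c) \<in> S \<and> \<bar>s - x0\<bar> + \<bar>c - y0\<bar> \<le> r"
        using cS[OF s] seg(2)[OF s] c_near hr by auto
    qed (rule r)
    also have "\<dots> \<le> C * r * r"
      using C0 hr h0 Mh0 by (intro mult_left_mono) (auto simp: h_def)
    finally have e2: "\<bar>f (x, c) - f (x0, c) - A * (x - x0)\<bar> \<le> C * r * r" .
    have "\<bar>f (x, y) - f (x, c) - B * (y - c)\<bar> \<le> C * r * \<bar>y - c\<bar>"
    proof (rule vertical)
      fix t assume t: "t \<in> closed_segment c y"
      have "\<bar>t - y0\<bar> \<le> \<bar>c - y0\<bar> + \<bar>y - y0\<bar>"
        using t by (auto simp: closed_segment_eq_real_ivl split: if_splits)
      then show "(x, t) \<in> S \<and> \<bar>x - x0\<bar> + \<bar>t - y0\<bar> \<le> r"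
        using vS[OF cS[of x] xy(1) t] c_near hr h0 Mh0 by (auto simp: h_def)
    qed (rule r)
    also have "\<dots> \<le> C * r * r"
      using C0 c_near hr h0 Mh0 by (intro mult_left_mono) auto
    finally have e3: "\<bar>f (x, y) - f (x, c) - B * (y - c)\<bar> \<le> C * r * r" .
    have "f (x, y) - f (x0, y0) - A * (x - x0) - B * (y - y0)
        = (f (x0, c) - f (x0, y0) - B * (c - y0)) + (f (x, c) - f (x0, c) - A * (x - x0))
          + (f (x, y) - f (x, c) - B * (y - c))"
      by (simp add: algebra_simps)
    then have "\<bar>f (x, y) - f (x0, y0) - A * (x - x0) - B * (y - y0)\<bar> \<le> 3 * (C * r * r)"
      using e1 e2 e3 by linarith
    also have "\<dots> = 3 * C * (1 + M)\<^sup>2 * (\<bar>x - x0\<bar> + \<bar>y - y0\<bar>)\<^sup>2"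
      by (simp add: r_def \<rho>_def h_def power2_eq_square)
    finally show "\<bar>f (x, y) - f (x0, y0) - A * (x - x0) - B * (y - y0)\<bar>
        \<le> 3 * C * (1 + M)\<^sup>2 * (\<bar>x - x0\<bar> + \<bar>y - y0\<bar>)\<^sup>2" .
  qed (use C0 dpos in auto)
qed

text \<open>
  With \<open>w = \<phi>2 x0 - \<phi>1 x0\<close>, the vertical displacement \<open>y - y0\<close> is linear in \<open>x - x0\<close> and
  \<open>v - v0\<close> with slopes \<open>(1 - v0) * \<phi>1' x0 + v0 * \<phi>2' x0\<close> and \<open>w\<close>, up to the quadratic errors of
  \<open>\<phi>1\<close>, \<open>\<phi>2\<close> and the mixed term \<open>(x - x0) * (v - v0)\<close>.  This gives the expansion near
  \<open>(x0, v0)\<close>.  At points that are not near, \<open>(x - x0)\<^sup>2 + (v - v0)\<^sup>2\<close> is bounded below and the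
  left-hand side is bounded above, so a larger constant suffices.
\<close>

lemma expansion_in_straightened_coordinates:
  fixes \<phi>1 \<phi>2 :: "real \<Rightarrow> real" and f :: "real \<times> real \<Rightarrow> real" and a b x0 y0 :: real
  defines "S \<equiv> curved_domain a b \<phi>1 \<phi>2"
  defines "w \<equiv> \<phi>2 x0 - \<phi>1 x0"
  defines "v0 \<equiv> (y0 - \<phi>1 x0) / w"
  assumes lt: "\<And>x. x \<in> {a..b} \<Longrightarrow> \<phi>1 x < \<phi>2 x"
    and bdd: "bounded (f ` S)"
    and p0: "(x0, y0) \<in> S"
    and partials: "has_second_partials_at_within f (x0, y0) S"
    and \<phi>1: "has_second_derivative_at_within \<phi>1 x0 {a..b}"
    and \<phi>2: "has_second_derivative_at_within \<phi>2 x0 {a..b}"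
  obtains \<alpha> \<beta> C where "0 \<le> C"
    "\<And>x v. x \<in> {a..b} \<Longrightarrow> v \<in> {0..1} \<Longrightarrow>
       \<bar>f (x, (\<phi>2 x - \<phi>1 x) * v + \<phi>1 x) - f (x0, y0) - \<alpha> * (x - x0) - \<beta> * (v - v0)\<bar>
         \<le> C * ((x - x0)\<^sup>2 + (v - v0)\<^sup>2)"
proof -
  have x0: "x0 \<in> {a..b}" using p0 by (simp add: S_def curved_domain_def)
  have w: "w > 0" using lt[OF x0] by (simp add: w_def)
  have y0_eq: "y0 = \<phi>1 x0 + w * v0"
    using w by (simp add: v0_def)
  have v0: "0 \<le> v0" "v0 \<le> 1"
    using p0 w by (auto simp: v0_def S_def curved_domain_def w_def)
  obtain c1 C1 d1 where C1: "C1 \<ge> 0" "d1 > 0"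
    "\<And>x. x \<in> {a..b} \<Longrightarrow> \<bar>x - x0\<bar> < d1 \<Longrightarrow> \<bar>\<phi>1 x - \<phi>1 x0 - c1 * (x - x0)\<bar> \<le> C1 * (x - x0)\<^sup>2"
    using second_derivative_imp_quadratic_error[OF \<phi>1 _ x0] by (metis convex_real_interval(5))
  obtain c2 C2 d2 where C2: "C2 \<ge> 0" "d2 > 0"
    "\<And>x. x \<in> {a..b} \<Longrightarrow> \<bar>x - x0\<bar> < d2 \<Longrightarrow> \<bar>\<phi>2 x - \<phi>2 x0 - c2 * (x - x0)\<bar> \<le> C2 * (x - x0)\<^sup>2"
    using second_derivative_imp_quadratic_error[OF \<phi>2 _ x0] by (metis convex_real_interval(5))
  define d0 where "d0 = min (min d1 d2) 1"
  define M where "M = \<bar>c1\<bar> + \<bar>c2\<bar> + C1 + C2"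
  have d0: "d0 > 0" and M: "0 \<le> M" using C1 C2 by (auto simp: d0_def M_def)
  have small_square: "(x - x0)\<^sup>2 \<le> \<bar>x - x0\<bar>" if "\<bar>x - x0\<bar> < d0" for x
  proof -
    have "\<bar>x - x0\<bar> * \<bar>x - x0\<bar> \<le> 1 * \<bar>x - x0\<bar>"
      using that by (intro mult_right_mono) (auto simp: d0_def)
    then show ?thesis by (simp add: power2_eq_square)
  qed
  have Lip: "\<bar>\<phi>1 x - \<phi>1 x0\<bar> \<le> M * \<bar>x - x0\<bar>" "\<bar>\<phi>2 x - \<phi>2 x0\<bar> \<le> M * \<bar>x - x0\<bar>"
    if "x \<in> {a..b}" "\<bar>x - x0\<bar> < d0" for x
  proof -
    let ?h = "\<bar>x - x0\<bar>"
    have q: "C1 * (x - x0)\<^sup>2 \<le> C1 * ?h" "C2 * (x - x0)\<^sup>2 \<le> C2 * ?h"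
      using small_square[OF that(2)] C1 C2 by (auto intro: mult_left_mono)
    have l: "\<bar>c1 * (x - x0)\<bar> = \<bar>c1\<bar> * ?h" "\<bar>c2 * (x - x0)\<bar> = \<bar>c2\<bar> * ?h"
      by (auto simp: abs_mult)
    have nn: "0 \<le> \<bar>c1\<bar> * ?h" "0 \<le> \<bar>c2\<bar> * ?h" "0 \<le> C1 * ?h" "0 \<le> C2 * ?h"
      using C1 C2 by auto
    have "M * ?h = \<bar>c1\<bar> * ?h + \<bar>c2\<bar> * ?h + C1 * ?h + C2 * ?h"
      by (simp add: M_def algebra_simps)
    moreover have "\<bar>\<phi>1 x - \<phi>1 x0 - c1 * (x - x0)\<bar> \<le> C1 * (x - x0)\<^sup>2"
        "\<bar>\<phi>2 x - \<phi>2 x0 - c2 * (x - x0)\<bar> \<le> C2 * (x - x0)\<^sup>2"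
      using C1(3) C2(3) that by (auto simp: d0_def)
    ultimately show "\<bar>\<phi>1 x - \<phi>1 x0\<bar> \<le> M * ?h" "\<bar>\<phi>2 x - \<phi>2 x0\<bar> \<le> M * ?h"
      using q l nn by linarith+
  qed
  obtain A B C d where C: "0 \<le> C" "0 < d"
    "\<And>x y. (x, y) \<in> S \<Longrightarrow> \<bar>x - x0\<bar> + \<bar>y - y0\<bar> < d \<Longrightarrow>
       \<bar>f (x, y) - f (x0, y0) - A * (x - x0) - B * (y - y0)\<bar> \<le> C * (\<bar>x - x0\<bar> + \<bar>y - y0\<bar>)\<^sup>2"
    using Taylor_of_slicewise_partials[OF p0[unfolded S_def] lt[OF x0] M d0 Lip partials[unfolded S_def]]
    unfolding S_def by metis
  define \<gamma> where "\<gamma> = c1 * (1 - v0) + c2 * v0"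
  define K where "K = \<bar>c2 - c1\<bar> + C1 + C2"
  define L where "L = 1 + M + w"
  define \<alpha> where "\<alpha> = A + B * \<gamma>"
  define \<beta> where "\<beta> = B * w"
  define \<eta> where "\<eta> = min d0 (d / L)"
  define C' where "C' = \<bar>B\<bar> * K + 2 * C * L\<^sup>2"
  have L: "L > 0" using M w by (simp add: L_def)
  have \<eta>: "\<eta> > 0" using d0 C L by (simp add: \<eta>_def)
  have K: "0 \<le> K" using C1 C2 by (simp add: K_def)
  have C'0: "0 \<le> C'" using C K by (simp add: C'_def)
  define e where "e = (\<lambda>x v. \<bar>f (x, (\<phi>2 x - \<phi>1 x) * v + \<phi>1 x) - f (x0, y0)
      - \<alpha> * (x - x0) - \<beta> * (v - v0)\<bar>)"
  define q where "q = (\<lambda>x v. (x - x0)\<^sup>2 + (v - v0)\<^sup>2)"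
  have inS: "(x, (\<phi>2 x - \<phi>1 x) * v + \<phi>1 x) \<in> S" if "x \<in> {a..b}" "v \<in> {0..1}" for x v
  proof -
    have "(\<phi>2 x - \<phi>1 x) * v \<le> (\<phi>2 x - \<phi>1 x) * 1" "0 \<le> (\<phi>2 x - \<phi>1 x) * v"
      using that lt[OF that(1)] by (auto intro!: mult_left_mono)
    then show ?thesis using that by (simp add: S_def curved_domain_def)
  qed
  have loc: "e x v \<le> C' * q x v"
    if x: "x \<in> {a..b}" and v: "v \<in> {0..1}" and small: "\<bar>x - x0\<bar> + \<bar>v - v0\<bar> < \<eta>" for x v
  proof -
    define h where "h = x - x0"
    define t where "t = v - v0"
    define y where "y = (\<phi>2 x - \<phi>1 x) * v + \<phi>1 x"
    define e1 where "e1 = \<phi>1 x - \<phi>1 x0 - c1 * h"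
    define e2 where "e2 = \<phi>2 x - \<phi>2 x0 - c2 * h"
    define R where "R = y - y0 - \<gamma> * h - w * t"
    have hd: "\<bar>h\<bar> < d0" using small by (auto simp: h_def \<eta>_def)
    have e12: "\<bar>e1\<bar> \<le> C1 * h\<^sup>2" "\<bar>e2\<bar> \<le> C2 * h\<^sup>2"
      using C1(3)[OF x] C2(3)[OF x] hd by (auto simp: d0_def e1_def e2_def h_def)
    have "0 \<le> C1 * t\<^sup>2" "0 \<le> C2 * t\<^sup>2" using C1 C2 by auto
    then have e12': "\<bar>e1\<bar> \<le> C1 * (h\<^sup>2 + t\<^sup>2)" "\<bar>e2\<bar> \<le> C2 * (h\<^sup>2 + t\<^sup>2)"
      using e12 by (auto simp: distrib_left)
    have amgm: "(\<bar>h\<bar> + \<bar>t\<bar>)\<^sup>2 \<le> 2 * (h\<^sup>2 + t\<^sup>2)" "\<bar>h * t\<bar> \<le> h\<^sup>2 + t\<^sup>2"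
    proof -
      define m where "m = \<bar>h * t\<bar>"
      have "0 \<le> (\<bar>h\<bar> - \<bar>t\<bar>)\<^sup>2" by simp
      then have m: "0 \<le> m" "2 * m \<le> h\<^sup>2 + t\<^sup>2"
        by (simp_all add: power2_diff abs_mult m_def)
      have "(\<bar>h\<bar> + \<bar>t\<bar>)\<^sup>2 = h\<^sup>2 + t\<^sup>2 + 2 * m"
        by (simp add: power2_sum abs_mult m_def)
      then show "(\<bar>h\<bar> + \<bar>t\<bar>)\<^sup>2 \<le> 2 * (h\<^sup>2 + t\<^sup>2)"
        using m by simp
      show "\<bar>h * t\<bar> \<le> h\<^sup>2 + t\<^sup>2"
        unfolding m_def[symmetric] using m by linarith
    qed
    \<comment> \<open>\<open>R\<close> is the error of the linearization of \<open>y - y0\<close>; the first summand is the mixed term.\<close>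
    have "R = (c2 - c1) * (h * t) + (1 - v) * e1 + v * e2"
      by (simp add: R_def y_def y0_eq \<gamma>_def e1_def e2_def t_def w_def algebra_simps)
    moreover have "\<bar>(c2 - c1) * (h * t)\<bar> \<le> \<bar>c2 - c1\<bar> * (h\<^sup>2 + t\<^sup>2)"
      unfolding abs_mult[of "c2 - c1"] using amgm by (intro mult_left_mono) auto
    moreover have "\<bar>(1 - v) * e1\<bar> \<le> 1 * (C1 * (h\<^sup>2 + t\<^sup>2))"
      unfolding abs_mult using v e12' by (intro mult_mono) auto
    moreover have "\<bar>v * e2\<bar> \<le> 1 * (C2 * (h\<^sup>2 + t\<^sup>2))"
      unfolding abs_mult using v e12' by (intro mult_mono) auto
    ultimately have R: "\<bar>R\<bar> \<le> K * (h\<^sup>2 + t\<^sup>2)"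
      unfolding K_def distrib_right by linarith
    have yy0: "\<bar>y - y0\<bar> \<le> M * \<bar>h\<bar> + w * \<bar>t\<bar>"
    proof -
      have "y - y0 = (1 - v) * (\<phi>1 x - \<phi>1 x0) + v * (\<phi>2 x - \<phi>2 x0) + w * t"
        by (simp add: y_def y0_eq t_def w_def algebra_simps)
      moreover have "\<bar>(1 - v) * (\<phi>1 x - \<phi>1 x0)\<bar> \<le> (1 - v) * (M * \<bar>h\<bar>)"
        unfolding abs_mult using v Lip(1)[OF x] hd by (intro mult_mono) (auto simp: h_def)
      moreover have "\<bar>v * (\<phi>2 x - \<phi>2 x0)\<bar> \<le> v * (M * \<bar>h\<bar>)"
        unfolding abs_mult using v Lip(2)[OF x] hd by (intro mult_mono) (auto simp: h_def)
      moreover have "\<bar>w * t\<bar> = w * \<bar>t\<bar>" using w by (simp add: abs_mult)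
      moreover have "(1 - v) * (M * \<bar>h\<bar>) + v * (M * \<bar>h\<bar>) = M * \<bar>h\<bar>" by (simp add: algebra_simps)
      ultimately show ?thesis by linarith
    qed
    have "\<bar>h\<bar> + (M * \<bar>h\<bar> + w * \<bar>t\<bar>) \<le> L * (\<bar>h\<bar> + \<bar>t\<bar>)"
      using M w by (simp add: L_def algebra_simps)
    then have size: "\<bar>h\<bar> + \<bar>y - y0\<bar> \<le> L * (\<bar>h\<bar> + \<bar>t\<bar>)" using yy0 by linarith
    have "L * (\<bar>h\<bar> + \<bar>t\<bar>) < d"
      using small L by (simp add: \<eta>_def h_def t_def field_simps)
    then have T: "\<bar>f (x, y) - f (x0, y0) - A * h - B * (y - y0)\<bar> \<le> C * (\<bar>h\<bar> + \<bar>y - y0\<bar>)\<^sup>2"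
      using C(3)[OF inS[OF x v]] size unfolding y_def[symmetric] h_def by simp
    have "C * (\<bar>h\<bar> + \<bar>y - y0\<bar>)\<^sup>2 \<le> C * (L * (\<bar>h\<bar> + \<bar>t\<bar>))\<^sup>2"
      using size C by (intro mult_left_mono power_mono) auto
    also have "\<dots> = C * L\<^sup>2 * (\<bar>h\<bar> + \<bar>t\<bar>)\<^sup>2" by (simp add: power_mult_distrib)
    also have "\<dots> \<le> C * L\<^sup>2 * (2 * (h\<^sup>2 + t\<^sup>2))"
      using amgm C by (intro mult_left_mono) auto
    also have "\<dots> = 2 * C * L\<^sup>2 * (h\<^sup>2 + t\<^sup>2)" by simp
    finally have T': "\<bar>f (x, y) - f (x0, y0) - A * h - B * (y - y0)\<bar> \<le> 2 * C * L\<^sup>2 * (h\<^sup>2 + t\<^sup>2)"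
      using T by linarith
    have BR: "\<bar>B * R\<bar> \<le> \<bar>B\<bar> * K * (h\<^sup>2 + t\<^sup>2)"
      using mult_left_mono[OF R, of "\<bar>B\<bar>"] by (simp add: abs_mult mult.assoc)
    have "e x v = \<bar>(f (x, y) - f (x0, y0) - A * h - B * (y - y0)) + B * R\<bar>"
      unfolding e_def y_def[symmetric] h_def[symmetric] t_def[symmetric]
      by (simp add: R_def \<alpha>_def \<beta>_def algebra_simps)
    also have "\<dots> \<le> C' * (h\<^sup>2 + t\<^sup>2)"
      using T' BR unfolding C'_def distrib_right by linarith
    finally show ?thesis by (simp add: q_def h_def t_def)
  qed
  obtain Q where Q: "\<And>p. p \<in> S \<Longrightarrow> \<bar>f p\<bar> \<le> Q"
    using bdd by (auto simp: bounded_iff)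
  define K' where "K' = 2 * Q + \<bar>\<alpha>\<bar> * (b - a) + \<bar>\<beta>\<bar>"
  have glob: "e x v \<le> K'" if x: "x \<in> {a..b}" and v: "v \<in> {0..1}" for x v
  proof -
    have "\<bar>\<alpha> * (x - x0)\<bar> \<le> \<bar>\<alpha>\<bar> * (b - a)"
      unfolding abs_mult using x x0 by (intro mult_left_mono) auto
    moreover have "\<bar>\<beta> * (v - v0)\<bar> \<le> \<bar>\<beta>\<bar> * 1"
      unfolding abs_mult using v v0 by (intro mult_left_mono) auto
    ultimately show ?thesis
      using Q[OF inS[OF x v]] Q[OF p0] unfolding K'_def e_def by linarith
  qed
  have K'0: "0 \<le> K'"
    using glob[OF x0, of 0] by (simp add: e_def)
  show ?thesis
  proof (rule that[of "C' + K' * 2 / \<eta>\<^sup>2" \<alpha> \<beta>])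
    fix x v :: real assume x: "x \<in> {a..b}" and v: "v \<in> {0..1}"
    have q0: "0 \<le> q x v" by (simp add: q_def)
    have "e x v \<le> (C' + K' * 2 / \<eta>\<^sup>2) * q x v"
    proof (cases "\<bar>x - x0\<bar> + \<bar>v - v0\<bar> < \<eta>")
      case True
      have "0 \<le> K' * 2 / \<eta>\<^sup>2 * q x v" using K'0 q0 by simp
      then show ?thesis using loc[OF x v True] by (simp add: distrib_right)
    next
      case False
      then have "\<eta>\<^sup>2 \<le> (\<bar>x - x0\<bar> + \<bar>v - v0\<bar>)\<^sup>2"
        using \<eta> by (intro power_mono) auto
      also have "\<dots> \<le> 2 * q x v"
      proof -
        have "0 \<le> (\<bar>x - x0\<bar> - \<bar>v - v0\<bar>)\<^sup>2" by simp
        then show ?thesis by (simp add: q_def power2_diff[of "\<bar>_\<bar>"] power2_sum[of "\<bar>_\<bar>"])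
      qed
      finally have "1 \<le> 2 * q x v / \<eta>\<^sup>2" using \<eta> by simp
      from mult_left_mono[OF this K'0] have "K' \<le> K' * 2 / \<eta>\<^sup>2 * q x v" by simp
      moreover have "0 \<le> C' * q x v" using C'0 q0 by simp
      ultimately show ?thesis using glob[OF x v] by (simp add: distrib_right)
    qed
    then show "\<bar>f (x, (\<phi>2 x - \<phi>1 x) * v + \<phi>1 x) - f (x0, y0) - \<alpha> * (x - x0) - \<beta> * (v - v0)\<bar>
         \<le> (C' + K' * 2 / \<eta>\<^sup>2) * ((x - x0)\<^sup>2 + (v - v0)\<^sup>2)"
      by (simp add: e_def q_def)
  qed (use C'0 K'0 in simp)
qed

section \<open>Moments of the binomial distribution\<close>

text \<open>
  For \<open>m = 0\<close> the only node \<open>0 / 0\<close> is \<open>0\<close>, so the first moment measures a bias.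
\<close>

lemma Bernstein_first_central_moment:
  "(\<Sum>j\<le>m. (real j / real m - v) * Bernstein m j v) = (if m = 0 then - v else 0)"
proof (cases "m = 0")
  case False
  have "(\<Sum>j\<le>m. (real j / real m - v) * Bernstein m j v)
      = (\<Sum>j\<le>m. real j * Bernstein m j v) / real m - v * (\<Sum>j\<le>m. Bernstein m j v)"
    by (simp only: left_diff_distrib times_divide_eq_left sum_subtractf sum_divide_distrib sum_distrib_left)
  also have "\<dots> = 0"
    using False by simp
  finally show ?thesis using False by simp
qed (simp add: Bernstein_def)

lemma Bernstein_second_central_moment:
  "(\<Sum>j\<le>m. (real j / real m - v)\<^sup>2 * Bernstein m j v) = (if m = 0 then v\<^sup>2 else v * (1 - v) / real m)"
proof (cases "m = 0")
  case False
  let ?B = "\<lambda>j. Bernstein m j v"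
  have "(\<Sum>j\<le>m. (real j / real m - v)\<^sup>2 * ?B j)
      = (\<Sum>j\<le>m. real j * (real j - 1) * ?B j / (real m)\<^sup>2
           + (1 / (real m)\<^sup>2 - 2 * v / real m) * (real j * ?B j) + v\<^sup>2 * ?B j)"
    using False by (intro sum.cong) (auto simp: field_simps power2_eq_square)
  also have "\<dots> = (\<Sum>j\<le>m. real j * (real j - 1) * ?B j) / (real m)\<^sup>2
      + (1 / (real m)\<^sup>2 - 2 * v / real m) * (\<Sum>j\<le>m. real j * ?B j) + v\<^sup>2 * (\<Sum>j\<le>m. ?B j)"
    by (simp only: sum.distrib sum_divide_distrib sum_distrib_left)
  also have "\<dots> = real m * (real m - 1) * v\<^sup>2 / (real m)\<^sup>2
      + (1 / (real m)\<^sup>2 - 2 * v / real m) * (real m * v) + v\<^sup>2"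
    by simp
  also have "\<dots> = v * (1 - v) / real m"
    using False by (simp add: field_simps power2_eq_square)
  finally show ?thesis using False by simp
qed (simp add: Bernstein_def)

text \<open>
  The denominator \<open>m + 1\<close> absorbs the degenerate case \<open>m = 0\<close>, and its reciprocal has an explicit
  binomial mean.  The factor \<open>v\<close> must be kept: it makes the bound vanish at \<open>v = 0\<close>.
\<close>

lemma Bernstein_second_central_moment_le:
  assumes "0 \<le> v" "v \<le> 1"
  shows "(\<Sum>j\<le>m. (real j / real m - v)\<^sup>2 * Bernstein m j v) \<le> 2 * v / (real m + 1)"
proof (cases "m = 0")
  case True
  have "v * v \<le> v * 2" using assms by (intro mult_left_mono) auto
  then show ?thesis
    unfolding Bernstein_second_central_moment using True by (simp add: power2_eq_square)
next
  case False
  have "v * (1 - v) / real m \<le> v / real m"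
    using assms by (intro divide_right_mono) (auto simp: mult_left_le)
  also have "\<dots> \<le> 2 * v / (real m + 1)"
    using False mult_left_mono[of 1 "real m" v] assms by (simp add: field_simps)
  finally show ?thesis using False by (simp add: Bernstein_second_central_moment)
qed

lemma Bernstein_reflect: "k \<le> n \<Longrightarrow> Bernstein n k s = Bernstein n (n - k) (1 - s)"
  by (simp add: Bernstein_def binomial_symmetric[of k n])

text \<open>
  Absorbing \<open>s * (n + 1) / (k + 1)\<close> into the binomial coefficient turns the \<open>k\<close>-th weight of
  degree \<open>n\<close> into the \<open>(k + 1)\<close>-st weight of degree \<open>n + 1\<close>; these sum to at most \<open>1\<close>.
\<close>

lemma Bernstein_reciprocal_moment:
  assumes "0 \<le> s" "s \<le> 1"
  shows "s * (\<Sum>k\<le>n. Bernstein n k s / (real k + 1)) \<le> 1 / (real n + 1)"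
proof -
  have *: "(real n + 1) * (s * (Bernstein n k s / (real k + 1))) = Bernstein (Suc n) (Suc k) s" for k
  proof -
    have "real (Suc k) * real (Suc n choose Suc k) = real (Suc n) * real (n choose k)"
      by (metis Suc_times_binomial_eq of_nat_mult mult.commute)
    then have "real (Suc n choose Suc k) = (real n + 1) * real (n choose k) / (real k + 1)"
      by (simp add: field_simps)
    then have "Bernstein (Suc n) (Suc k) s
        = (real n + 1) * real (n choose k) / (real k + 1) * s ^ Suc k * (1 - s) ^ (n - k)"
      unfolding Bernstein_def by (simp del: binomial_Suc_Suc)
    then show ?thesis by (simp add: Bernstein_def)
  qed
  have "(real n + 1) * (s * (\<Sum>k\<le>n. Bernstein n k s / (real k + 1)))
      = (\<Sum>k\<le>n. Bernstein (Suc n) (Suc k) s)"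
    unfolding sum_distrib_left * ..
  also have "\<dots> \<le> Bernstein (Suc n) 0 s + (\<Sum>k\<le>n. Bernstein (Suc n) (Suc k) s)"
    using Bernstein_nonneg[OF assms] by simp
  also have "\<dots> = 1"
    using sum_Bernstein[of "Suc n" s] by (simp only: sum.atMost_Suc_shift)
  finally show ?thesis by (simp add: field_simps)
qed

lemma Bernstein_reciprocal_moment_reflected:
  assumes "0 \<le> s" "s \<le> 1"
  shows "(1 - s) * (\<Sum>k\<le>n. Bernstein n k s / (real (n - k) + 1)) \<le> 1 / (real n + 1)"
proof -
  have "(\<Sum>k\<le>n. Bernstein n k s / (real (n - k) + 1))
      = (\<Sum>k\<le>n. Bernstein n (n - k) (1 - s) / (real (n - k) + 1))"
    by (intro sum.cong) (auto simp: Bernstein_reflect[of _ n s])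
  also have "\<dots> = (\<Sum>k\<le>n. Bernstein n k (1 - s) / (real k + 1))"
    by (rule sum.reindex_bij_witness[of _ "\<lambda>k. n - k" "\<lambda>k. n - k"]) auto
  finally show ?thesis using Bernstein_reciprocal_moment[of "1 - s" n] assms by simp
qed

section \<open>Averages over the nodes\<close>

text \<open>
  In the application, \<open>g\<close> is the function on one vertical line of nodes and \<open>r\<close> is the squared
  horizontal distance of that line to the point of expansion.
\<close>

lemma Bernstein_average_inner:
  fixes g :: "real \<Rightarrow> real"
  assumes t: "0 \<le> t" "t \<le> 1" and C: "0 \<le> C"
    and g: "\<And>v. v \<in> {0..1} \<Longrightarrow> \<bar>g v - c - \<beta> * (v - t)\<bar> \<le> C * (r + (v - t)\<^sup>2)"
  shows "\<bar>(\<Sum>j\<le>m. g (real j / real m) * Bernstein m j t) - c\<bar>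
           \<le> C * r + (\<bar>\<beta>\<bar> + 2 * C) * (t / (real m + 1))"
proof -
  let ?v = "\<lambda>j. real j / real m" and ?B = "\<lambda>j. Bernstein m j t"
  have "(\<Sum>j\<le>m. g (?v j) * ?B j) - c - \<beta> * (\<Sum>j\<le>m. (?v j - t) * ?B j)
      = (\<Sum>j\<le>m. g (?v j) * ?B j) - c * (\<Sum>j\<le>m. ?B j) - \<beta> * (\<Sum>j\<le>m. (?v j - t) * ?B j)"
    by simp
  also have "\<dots> = (\<Sum>j\<le>m. (g (?v j) - c - \<beta> * (?v j - t)) * ?B j)"
    by (simp only: sum_distrib_left sum_subtractf[symmetric]) (simp add: algebra_simps)
  finally have "\<bar>(\<Sum>j\<le>m. g (?v j) * ?B j) - c - \<beta> * (\<Sum>j\<le>m. (?v j - t) * ?B j)\<bar>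
      = \<bar>\<Sum>j\<le>m. (g (?v j) - c - \<beta> * (?v j - t)) * ?B j\<bar>" by simp
  also have "\<dots> \<le> (\<Sum>j\<le>m. C * (r + (?v j - t)\<^sup>2) * ?B j)"
  proof (rule order_trans[OF sum_abs sum_mono])
    fix j assume "j \<in> {..m}"
    then have "?v j \<in> {0..1}" by (auto simp: divide_le_eq)
    from g[OF this] Bernstein_nonneg[OF t] show
      "\<bar>(g (?v j) - c - \<beta> * (?v j - t)) * ?B j\<bar> \<le> C * (r + (?v j - t)\<^sup>2) * ?B j"
      by (simp add: abs_mult mult_right_mono)
  qed
  also have "\<dots> = C * (r * (\<Sum>j\<le>m. ?B j) + (\<Sum>j\<le>m. (?v j - t)\<^sup>2 * ?B j))"
    by (simp only: sum_distrib_left distrib_right distrib_left sum.distrib mult.assoc)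
  also have "\<dots> \<le> C * (r + 2 * t / (real m + 1))"
    using C Bernstein_second_central_moment_le[OF t] by (intro mult_left_mono) auto
  finally have 1: "\<bar>(\<Sum>j\<le>m. g (?v j) * ?B j) - c - \<beta> * (\<Sum>j\<le>m. (?v j - t) * ?B j)\<bar>
      \<le> C * (r + 2 * t / (real m + 1))" .
  have "\<bar>\<Sum>j\<le>m. (?v j - t) * ?B j\<bar> \<le> t / (real m + 1)"
    unfolding Bernstein_first_central_moment using t by simp
  then have "\<bar>\<beta> * (\<Sum>j\<le>m. (?v j - t) * ?B j)\<bar> \<le> \<bar>\<beta>\<bar> * (t / (real m + 1))"
    unfolding abs_mult by (rule mult_left_mono) simp
  moreover have "C * (r + 2 * t / (real m + 1)) + \<bar>\<beta>\<bar> * (t / (real m + 1))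
      = C * r + (\<bar>\<beta>\<bar> + 2 * C) * (t / (real m + 1))"
    by (simp add: distrib_left distrib_right add_divide_distrib mult_ac)
  ultimately show ?thesis using 1 by linarith
qed

text \<open>
  The inner averages are \<open>c + \<alpha> * (k / n - s)\<close> up to the inner error; the outer average annihilates
  \<open>k / n - s\<close> and turns the errors into a variance and a reciprocal moment, both \<open>O(1 / n)\<close>.  For
  \<open>p = 0\<close> the hypothesis on \<open>m\<close> is void, but then \<open>t = 0\<close>, and \<open>t / p = 0\<close> is the right constant.
\<close>

lemma Bernstein_average_iterated:
  fixes g :: "real \<Rightarrow> real \<Rightarrow> real" and m :: "nat \<Rightarrow> nat"
  assumes s: "0 \<le> s" "s \<le> 1" and t: "0 \<le> t" "t \<le> 1" and C: "0 \<le> C" and n: "n > 0"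
    and g: "\<And>u v. u \<in> {0..1} \<Longrightarrow> v \<in> {0..1} \<Longrightarrow>
              \<bar>g u v - c - \<alpha> * (u - s) - \<beta> * (v - t)\<bar> \<le> C * ((u - s)\<^sup>2 + (v - t)\<^sup>2)"
    and p: "0 \<le> p" "p = 0 \<Longrightarrow> t = 0"
    and m: "p * (\<Sum>k\<le>n. Bernstein n k s / (real (m k) + 1)) \<le> 1 / (real n + 1)"
  shows "\<bar>(\<Sum>k\<le>n. (\<Sum>j\<le>m k. g (real k / real n) (real j / real (m k)) * Bernstein (m k) j t)
              * Bernstein n k s) - c\<bar>
           \<le> (C + (\<bar>\<beta>\<bar> + 2 * C) * (t / p)) / real n"
proof -
  let ?u = "\<lambda>k. real k / real n" and ?B = "\<lambda>k. Bernstein n k s"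
  define Q where "Q k = (\<Sum>j\<le>m k. g (?u k) (real j / real (m k)) * Bernstein (m k) j t)" for k
  define b where "b = \<bar>\<beta>\<bar> + 2 * C"
  have b: "0 \<le> b" using C by (simp add: b_def)
  have Q: "\<bar>Q k - (c + \<alpha> * (?u k - s))\<bar> \<le> C * (?u k - s)\<^sup>2 + b * (t / (real (m k) + 1))"
    if "k \<le> n" for k
    unfolding Q_def b_def
  proof (rule Bernstein_average_inner[OF t C])
    fix v :: real assume "v \<in> {0..1}"
    moreover have "?u k \<in> {0..1}" using that by (auto simp: divide_le_eq)
    ultimately show "\<bar>g (?u k) v - (c + \<alpha> * (?u k - s)) - \<beta> * (v - t)\<bar> \<le> C * ((?u k - s)\<^sup>2 + (v - t)\<^sup>2)"
      using g[of "?u k" v] by (simp add: algebra_simps)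
  qed
  have z: "(\<Sum>k\<le>n. (?u k - s) * ?B k) = 0"
    unfolding Bernstein_first_central_moment using n by simp
  have "(\<Sum>k\<le>n. Q k * ?B k) - c
      = (\<Sum>k\<le>n. Q k * ?B k) - c * (\<Sum>k\<le>n. ?B k) - \<alpha> * (\<Sum>k\<le>n. (?u k - s) * ?B k)"
    by (simp add: z)
  also have "\<dots> = (\<Sum>k\<le>n. (Q k - (c + \<alpha> * (?u k - s))) * ?B k)"
    by (simp only: sum_distrib_left sum_subtractf[symmetric]) (simp add: algebra_simps)
  finally have "\<bar>(\<Sum>k\<le>n. Q k * ?B k) - c\<bar> = \<bar>\<Sum>k\<le>n. (Q k - (c + \<alpha> * (?u k - s))) * ?B k\<bar>"
    by simp
  also have "\<dots> \<le> (\<Sum>k\<le>n. (C * (?u k - s)\<^sup>2 + b * (t / (real (m k) + 1))) * ?B k)"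
  proof (rule order_trans[OF sum_abs sum_mono])
    fix k assume "k \<in> {..n}"
    then show "\<bar>(Q k - (c + \<alpha> * (?u k - s))) * ?B k\<bar>
        \<le> (C * (?u k - s)\<^sup>2 + b * (t / (real (m k) + 1))) * ?B k"
      using Q[of k] Bernstein_nonneg[OF s] by (simp add: abs_mult mult_right_mono)
  qed
  also have "\<dots> = (\<Sum>k\<le>n. C * ((?u k - s)\<^sup>2 * ?B k) + b * (t * (?B k / (real (m k) + 1))))"
    by (intro sum.cong) (auto simp: algebra_simps)
  also have "\<dots> = C * (\<Sum>k\<le>n. (?u k - s)\<^sup>2 * ?B k) + b * (t * (\<Sum>k\<le>n. ?B k / (real (m k) + 1)))"
    by (simp only: sum.distrib sum_distrib_left)
  also have "\<dots> \<le> C * (1 / real n) + b * (t / p / real n)"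
  proof (intro add_mono mult_left_mono)
    have "s * (1 - s) / real n \<le> 1 / real n"
      using s by (intro divide_right_mono) (auto intro: mult_le_one)
    then show "(\<Sum>k\<le>n. (?u k - s)\<^sup>2 * ?B k) \<le> 1 / real n"
      unfolding Bernstein_second_central_moment using n by simp
    show "t * (\<Sum>k\<le>n. ?B k / (real (m k) + 1)) \<le> t / p / real n"
    proof (cases "p = 0")
      case False
      have "1 / (real n + 1) \<le> 1 / real n" using n by (simp add: field_simps)
      with m have "p * (\<Sum>k\<le>n. ?B k / (real (m k) + 1)) \<le> 1 / real n" by linarith
      then have "(\<Sum>k\<le>n. ?B k / (real (m k) + 1)) \<le> 1 / real n / p"
        using False p by (subst pos_le_divide_eq) (auto simp: mult.commute)
      from mult_left_mono[OF this t(1)] show ?thesis by (simp add: mult.commute)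
    qed (use p in simp)
  qed (use C b in auto)
  also have "\<dots> = (C + b * (t / p)) / real n" by (simp add: add_divide_distrib)
  finally show ?thesis unfolding Q_def b_def .
qed

section \<open>Rate of convergence\<close>

theorem theorem5p4:
  fixes a b x0 y0 :: real
    and \<phi>1 \<phi>2 :: "real \<Rightarrow> real"
    and f :: "real \<times> real \<Rightarrow> real"
    and N :: "nat \<Rightarrow> nat \<Rightarrow> nat"
  assumes "a < b"
    and "continuous_on {a..b} \<phi>1" and "continuous_on {a..b} \<phi>2"
    and "\<forall>x\<in>{a..b}. \<phi>1 x < \<phi>2 x"
    and "(\<forall>n. \<forall>k\<le>n. N n k = n - k) \<or> (\<forall>n. \<forall>k\<le>n. N n k = k)"
    and "bounded (f ` curved_domain a b \<phi>1 \<phi>2)"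
    and "(x0, y0) \<in> curved_domain a b \<phi>1 \<phi>2"
    and "has_second_partials_at_within f (x0, y0) (curved_domain a b \<phi>1 \<phi>2)"
    and "has_second_derivative_at_within \<phi>1 x0 {a..b}"
    and "has_second_derivative_at_within \<phi>2 x0 {a..b}"
    \<comment> \<open>On the vertical edge where the only node with nonzero weight has \<open>n\<^sub>k = 0\<close>, the operator
        returns the value of \<open>f\<close> at the lower corner, so the rest of that edge is excluded.\<close>
    and "(\<forall>n. \<forall>k\<le>n. N n k = n - k) \<Longrightarrow> x0 = b \<Longrightarrow> y0 = \<phi>1 b"
    and "(\<forall>n. \<forall>k\<le>n. N n k = k) \<Longrightarrow> x0 = a \<Longrightarrow> y0 = \<phi>1 a"
  shows "(\<lambda>n. shifted_Bernstein_Stancu N a b \<phi>1 \<phi>2 n f (x0, y0) - f (x0, y0))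
           \<in> O(\<lambda>n. 1 / real n)"
proof -
  define l where "l = b - a"
  define s where "s = (x0 - a) / l"
  define t where "t = (y0 - \<phi>1 x0) / (\<phi>2 x0 - \<phi>1 x0)"
  have l: "l > 0" using assms(1) by (simp add: l_def)
  have dom: "x0 \<in> {a..b}" "\<phi>1 x0 \<le> y0" "y0 \<le> \<phi>2 x0"
    using assms(7) by (auto simp: curved_domain_def)
  have s: "0 \<le> s" "s \<le> 1" using dom l by (auto simp: s_def l_def)
  have t: "0 \<le> t" "t \<le> 1" using dom assms(4) by (auto simp: t_def divide_le_eq)
  have x0_eq: "x0 = l * s + a" using l by (simp add: s_def)
  obtain \<alpha> \<beta> C where C: "0 \<le> C"
    "\<And>x v. x \<in> {a..b} \<Longrightarrow> v \<in> {0..1} \<Longrightarrow>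
       \<bar>f (x, (\<phi>2 x - \<phi>1 x) * v + \<phi>1 x) - f (x0, y0) - \<alpha> * (x - x0) - \<beta> * (v - t)\<bar>
         \<le> C * ((x - x0)\<^sup>2 + (v - t)\<^sup>2)"
    using expansion_in_straightened_coordinates[OF _ assms(6-10)] assms(4) unfolding t_def by metis
  define C' where "C' = C * (1 + l\<^sup>2)"
  have C': "0 \<le> C'" using C by (simp add: C'_def)
  have g: "\<bar>shift_fun2 a b \<phi>1 \<phi>2 f u v - f (x0, y0) - (\<alpha> * l) * (u - s) - \<beta> * (v - t)\<bar>
      \<le> C' * ((u - s)\<^sup>2 + (v - t)\<^sup>2)" if u: "u \<in> {0..1}" and v: "v \<in> {0..1}" for u v
  proof -
    define x where "x = l * u + a"
    have "l * u \<le> l * 1" "0 \<le> l * u" using u l by (auto intro!: mult_left_mono)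
    then have x: "x \<in> {a..b}" by (simp add: x_def l_def)
    have xx: "x - x0 = l * (u - s)" by (simp add: x_def x0_eq algebra_simps)
    have "\<bar>shift_fun2 a b \<phi>1 \<phi>2 f u v - f (x0, y0) - (\<alpha> * l) * (u - s) - \<beta> * (v - t)\<bar>
        \<le> C * ((l * (u - s))\<^sup>2 + (v - t)\<^sup>2)"
      using C(2)[OF x v] unfolding xx shift_fun2_def shift_fun_def l_def[symmetric] x_def[symmetric]
      by (simp add: mult.assoc)
    also have "\<dots> \<le> C * ((1 + l\<^sup>2) * ((u - s)\<^sup>2 + (v - t)\<^sup>2))"
      using C(1) by (intro mult_left_mono) (auto simp: power_mult_distrib distrib_left distrib_right)
    finally show ?thesis by (simp add: C'_def mult.assoc)
  qed
  \<comment> \<open>\<open>p\<close> is the success probability of the binomially distributed \<open>n\<^sub>k\<close>; it vanishes only on the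
      exceptional vertical edge.\<close>
  obtain p where p: "0 \<le> p" "p = 0 \<Longrightarrow> t = 0"
    "\<And>n. p * (\<Sum>k\<le>n. Bernstein n k s / (real (N n k) + 1)) \<le> 1 / (real n + 1)"
  proof (cases "\<forall>n. \<forall>k\<le>n. N n k = n - k")
    case True
    show ?thesis
    proof (rule that[of "1 - s"])
      show "t = 0" if "1 - s = 0"
        using that assms(11)[OF True] x0_eq by (simp add: t_def l_def)
      show "(1 - s) * (\<Sum>k\<le>n. Bernstein n k s / (real (N n k) + 1)) \<le> 1 / (real n + 1)" for n
        using Bernstein_reciprocal_moment_reflected[OF s, of n] True by simp
    qed (use s in simp)
  next
    case False
    then have N: "\<forall>n. \<forall>k\<le>n. N n k = k" using assms(5) by blast
    show ?thesis
    proof (rule that[of s])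
      show "t = 0" if "s = 0"
        using that assms(12)[OF N] x0_eq by (simp add: t_def)
      show "s * (\<Sum>k\<le>n. Bernstein n k s / (real (N n k) + 1)) \<le> 1 / (real n + 1)" for n
        using Bernstein_reciprocal_moment[OF s, of n] N by simp
    qed (use s in simp)
  qed
  have "shifted_Bernstein_Stancu N a b \<phi>1 \<phi>2 n f (x0, y0)
      = (\<Sum>k\<le>n. (\<Sum>j\<le>N n k. shift_fun2 a b \<phi>1 \<phi>2 f (real k / real n) (real j / real (N n k))
          * Bernstein (N n k) j t) * Bernstein n k s)" for n
    by (simp add: shifted_Bernstein_Stancu_def s_def t_def l_def atLeast0AtMost sum_distrib_left
        mult_ac)
  then have "\<bar>shifted_Bernstein_Stancu N a b \<phi>1 \<phi>2 n f (x0, y0) - f (x0, y0)\<bar>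
      \<le> (C' + (\<bar>\<beta>\<bar> + 2 * C') * (t / p)) / real n" if "n > 0" for n
    using Bernstein_average_iterated[OF s t C' that g p] by simp
  then show ?thesis
    by (intro bigoI[of _ "C' + (\<bar>\<beta>\<bar> + 2 * C') * (t / p)"] eventually_mono[OF eventually_gt_at_top[of 0]])
       simp
qed

end
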